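(* Let $\mathbf k$ be a field of characteristic $0$, $\lambda\in\mathbf k$, and let $(\mathfrak g,d_{\mathfrak g})$ be a differential Lie algebra of weight $\lambda$. If $(\mathfrak g[[t]],\mu_t,d_t)$ and $(\mathfrak g[[t]],\bar\mu_t,\bar d_t)$ are two equivalent $1$-parameter formal deformations of $(\mathfrak g,d_{\mathfrak g})$, then their infinitesimals $(\mu_1,d_1)$ and $(\bar\mu_1,\bar d_1)$ are in the same cohomology class in $\tilde{\mathrm H}^2_{\mathrm{DL}_\lambda}(\mathfrak g,\mathfrak g_{\mathrm{ad}})$.
   Context: A differential Lie algebra of weight $\lambda$ is a Lie algebra $\mathfrak g$ (bracket $\mu_{\mathfrak g}=[\,,]$) with a linear map $d_{\mathfrak g}$ such that $d_{\mathfrak g}([x,y])=[d_{\mathfrak g}(x),y]+[x,d_{\mathfrak g}(y)]+\lambda[d_{\mathfrak g}(x),d_{\mathfrak g}(y)]$. A $1$-parameter formal deformation is a pair $\mu_t=\sum_{i\ge0}\mu_it^i$, $d_t=\sum_{i\ge0}d_it^i$, $\mu_i\in\mathrm{Hom}(\wedge^2\mathfrak g,\mathfrak g)$, $d_i\in\mathrm{Hom}(\mathfrak g,\mathfrak g)$, making $\mathfrak g[[t]]$ a differential Lie algebra of weight $\lambda$ over $\mathbf k[[t]]$, with $(\mu_0,d_0)=(\mu_{\mathfrak g},d_{\mathfrak g})$. Its infinitesimal is $(\mu_1,d_1)$, which is a $2$-cocycle of the complex below. Two deformations are equivalent if there is a formal isomorphism $\Phi_t=\sum_{i\ge0}\phi_it^i$,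 $\phi_i:\mathfrak g\to\mathfrak g$ linear, $\phi_0=\mathrm{Id}$, with $\Phi_t\circ\bar\mu_t=\mu_t\circ(\Phi_t\times\Phi_t)$ and $\Phi_t\circ\bar d_t=d_t\circ\Phi_t$. Adjoint representation: $V=\mathfrak g$, $\rho(x)=[x,-]$, $d_V=d_{\mathfrak g}$; $\rho_\lambda(x)=\rho(x+\lambda d_{\mathfrak g}(x))$. For $f\in\mathrm{Hom}(\wedge^n\mathfrak g,V)$, $$\partial^n_{\mathrm{Lie}}(f)(x_1,\dots,x_{n+1})=\sum_{i}(-1)^{i+n}\rho(x_i)f(x_1,\dots,\hat x_i,\dots,x_{n+1})+\sum_{i<j}(-1)^{i+j+n+1}f([x_i,x_j],x_1,\dots,\hat x_i,\dots,\hat x_j,\dots,x_{n+1}),$$ $\partial^n_{\mathrm{DO}_\lambda}$ is the same with $\rho_\lambda$ in place of $\rho$, and $$\delta^nf(x_1,\dots,x_n)=\sum_{k=1}^n\lambda^{k-1}\sum_{i_1<\dots<i_k}f(x_1,\dots,d_{\mathfrak g}(x_{i_1}),\dots,d_{\mathfrak g}(x_{i_k}),\dots,x_n)-d_Vf(x_1,\dots,x_n).$$ The complex $\tilde{\mathrm C}^*_{\mathrm{DL}_\lambda}(\mathfrak g,V)$ is $0$ in degree $0$, $\mathrm{Hom}(\mathfrak g,V)$ in degree $1$, and $\mathrm{Hom}(\wedge^n\mathfrak g,V)\oplus\mathrm{Hom}(\wedge^{n-1}\mathfrak g,V)$ for $n\ge2$, with differential $\partial^n_{\mathrm{DL}_\lambda}(f,g)=(\partial^n_{\mathrm{Lie}}f,-\partial^{n-1}_{\mathrm{DO}_\lambda}g-\delta^nf)$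 (with $g=0$ when $n=1$). Its cohomology is $\tilde{\mathrm H}^*_{\mathrm{DL}_\lambda}(\mathfrak g,V)$. *)

theory Defs
  imports
    "HOL-Computational_Algebra.Formal_Power_Series"
    "HOL-Library.Function_Algebras"
    "HOL-Library.Product_Plus"
begin

section \<open>Differential Lie algebras\<close>

text \<open>The base is a commutative ring so that the same notion serves over a field
  and over the power series ring of that field.\<close>

definition alternating_bilinear ::
  "('r::comm_ring_1 \<Rightarrow> 'g::ab_group_add \<Rightarrow> 'g) \<Rightarrow> ('g \<Rightarrow> 'g \<Rightarrow> 'g) \<Rightarrow> bool"
where
  "alternating_bilinear scale m \<longleftrightarrow>
     (\<forall>x. module_hom scale scale (m x)) \<and>
     (\<forall>y. module_hom scale scale (\<lambda>x. m x y)) \<and>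
     (\<forall>x. m x x = 0)"

locale lie_algebra = module scale
  for scale :: "'r::comm_ring_1 \<Rightarrow> 'g::ab_group_add \<Rightarrow> 'g" +
  fixes bracket :: "'g \<Rightarrow> 'g \<Rightarrow> 'g"
  assumes bracket_alternating_bilinear: "alternating_bilinear scale bracket"
    and jacobi:
      "bracket x (bracket y z) + bracket y (bracket z x) + bracket z (bracket x y) = 0"

locale differential_lie_algebra = lie_algebra scale bracket
  for scale :: "'r::comm_ring_1 \<Rightarrow> 'g::ab_group_add \<Rightarrow> 'g"
    and bracket :: "'g \<Rightarrow> 'g \<Rightarrow> 'g" +
  fixes wt :: 'r
    and d :: "'g \<Rightarrow> 'g"
  assumes d_linear: "module_hom scale scale d"
    and d_bracket:
      "d (bracket x y) =
         bracket (d x) y + bracket x (d y) + scale wt (bracket (d x) (d y))"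


section \<open>The cochain complex of a representation\<close>

locale differential_lie_rep =
  differential_lie_algebra scale bracket wt d + V: module scaleV
  for scale :: "'r::comm_ring_1 \<Rightarrow> 'g::ab_group_add \<Rightarrow> 'g"
    and bracket :: "'g \<Rightarrow> 'g \<Rightarrow> 'g"
    and wt :: 'r
    and d :: "'g \<Rightarrow> 'g"
    and scaleV :: "'r \<Rightarrow> 'v::ab_group_add \<Rightarrow> 'v" +
  fixes rho :: "'g \<Rightarrow> 'v \<Rightarrow> 'v"
    and dV :: "'v \<Rightarrow> 'v"
  assumes rho_linear_left: "module_hom scale scaleV (\<lambda>x. rho x v)"
    and rho_linear_right: "module_hom scaleV scaleV (rho x)"
    and rho_bracket: "rho (bracket x y) v = rho x (rho y v) - rho y (rho x v)"
    and dV_linear: "module_hom scaleV scaleV dV"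
    and dV_rho: "dV (rho x v) = rho (d x) v + rho x (dV v) + scaleV wt (rho (d x) (dV v))"
begin

text \<open>An alternating \<open>n\<close>-linear map is a function on lists. Its value off the lists of
  length \<open>n\<close> is fixed to be 0, so that equality of cochains is equality of functions.\<close>

definition Hom_wedge :: "nat \<Rightarrow> ('g list \<Rightarrow> 'v) set" where
  "Hom_wedge n = {f.
     (\<forall>xs. length xs \<noteq> n \<longrightarrow> f xs = 0) \<and>
     (\<forall>xs i. length xs = n \<longrightarrow> i < n \<longrightarrow> module_hom scale scaleV (\<lambda>x. f (xs[i := x]))) \<and>
     (\<forall>xs i j. length xs = n \<longrightarrow> i < j \<longrightarrow> j < n \<longrightarrow> xs ! i = xs ! j \<longrightarrow> f xs = 0)}"

definition rho_wt :: "'g \<Rightarrow> 'v \<Rightarrow> 'v" where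
  "rho_wt x = rho (x + scale wt (d x))"

text \<open>The Chevalley--Eilenberg differential with respect to an action \<open>r\<close>. List positions
  count from 0, hence \<open>Suc i\<close> and \<open>Suc j\<close> in the signs; \<open>nths xs (- A)\<close> deletes the
  entries at the positions in \<open>A\<close>.\<close>

definition ce_diff ::
  "('g \<Rightarrow> 'v \<Rightarrow> 'v) \<Rightarrow> nat \<Rightarrow> ('g list \<Rightarrow> 'v) \<Rightarrow> 'g list \<Rightarrow> 'v"
where
  "ce_diff r n f xs =
     (if length xs = Suc n then
        (\<Sum>i<Suc n. scaleV ((-1) ^ (Suc i + n)) (r (xs ! i) (f (nths xs (- {i}))))) +
        (\<Sum>j<Suc n. \<Sum>i<j. scaleV ((-1) ^ (Suc i + Suc j + n + 1))
            (f (bracket (xs ! i) (xs ! j) # nths xs (- {i, j}))))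
      else 0)"

definition lie_diff :: "nat \<Rightarrow> ('g list \<Rightarrow> 'v) \<Rightarrow> 'g list \<Rightarrow> 'v" where
  "lie_diff = ce_diff rho"

definition do_diff :: "nat \<Rightarrow> ('g list \<Rightarrow> 'v) \<Rightarrow> 'g list \<Rightarrow> 'v" where
  "do_diff = ce_diff rho_wt"

text \<open>The increasing tuples of length \<open>k\<close> of positions are the \<open>k\<close>-element sets of positions.\<close>

definition delta :: "nat \<Rightarrow> ('g list \<Rightarrow> 'v) \<Rightarrow> 'g list \<Rightarrow> 'v" where
  "delta n f xs =
     (if length xs = n then
        (\<Sum>k=1..n. scaleV (wt ^ (k - 1))
           (\<Sum>I\<in>{I. I \<subseteq> {..<n} \<and> card I = k}.
              f (map (\<lambda>i. if i \<in> I then d (xs ! i) else xs ! i) [0..<n])))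
        - dV (f xs)
      else 0)"

text \<open>Cochains of all degrees are pairs; the components absent in degrees 0 and 1 are 0.\<close>

definition cochains :: "nat \<Rightarrow> (('g list \<Rightarrow> 'v) \<times> ('g list \<Rightarrow> 'v)) set" where
  "cochains n =
     (if n = 0 then {0}
      else if n = 1 then Hom_wedge 1 \<times> {0}
      else Hom_wedge n \<times> Hom_wedge (n - 1))"

definition differential ::
  "nat \<Rightarrow> ('g list \<Rightarrow> 'v) \<times> ('g list \<Rightarrow> 'v) \<Rightarrow> ('g list \<Rightarrow> 'v) \<times> ('g list \<Rightarrow> 'v)"
where
  "differential n = (\<lambda>(f, g). (lie_diff n f, - do_diff (n - 1) g - delta n f))"

definition cocycles :: "nat \<Rightarrow> (('g list \<Rightarrow> 'v) \<times> ('g list \<Rightarrow> 'v)) set" where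
  "cocycles n = {c \<in> cochains n. differential n c = 0}"

definition coboundaries :: "nat \<Rightarrow> (('g list \<Rightarrow> 'v) \<times> ('g list \<Rightarrow> 'v)) set" where
  "coboundaries n = (if n = 0 then {0} else differential (n - 1) ` cochains (n - 1))"

definition cohomologous ::
  "nat \<Rightarrow> ((('g list \<Rightarrow> 'v) \<times> ('g list \<Rightarrow> 'v)) \<times> (('g list \<Rightarrow> 'v) \<times> ('g list \<Rightarrow> 'v))) set"
where
  "cohomologous n = {(c, c'). c \<in> cocycles n \<and> c' \<in> cocycles n \<and> c - c' \<in> coboundaries n}"

definition cohomology :: "nat \<Rightarrow> (('g list \<Rightarrow> 'v) \<times> ('g list \<Rightarrow> 'v)) set set" where
  "cohomology n = cocycles n // cohomologous n"

end

context differential_lie_algebra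
begin

lemma bracket_hom:
  "module_hom scale scale (bracket x)" "module_hom scale scale (\<lambda>x. bracket x y)"
  "bracket x x = 0"
  using bracket_alternating_bilinear by (auto simp: alternating_bilinear_def)

lemma bracket_skew: "bracket x y = - bracket y x"
proof -
  have "bracket x y + bracket y x = bracket (x + y) (x + y)"
    unfolding module_hom.add[OF bracket_hom(1)] module_hom.add[OF bracket_hom(2)]
    by (simp add: bracket_hom(3) add.commute)
  also have "\<dots> = 0" by (rule bracket_hom)
  finally have "bracket x y + bracket y x = 0" .
  then show ?thesis by (simp add: eq_neg_iff_add_eq_0)
qed

sublocale adjoint: differential_lie_rep scale bracket wt d scale bracket d
proof
  fix x y v
  have "bracket (bracket x y) v = - bracket v (bracket x y)" by (rule bracket_skew)
  also have "\<dots> = bracket x (bracket y v) + bracket y (bracket v x)"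
    using jacobi[of x y v] by (simp add: eq_neg_iff_add_eq_0 neg_eq_iff_add_eq_0 add.commute)
  also have "bracket y (bracket v x) = - bracket y (bracket x v)"
    by (simp add: bracket_skew[of v x] module_hom.neg[OF bracket_hom(1)])
  finally show "bracket (bracket x y) v = bracket x (bracket y v) - bracket y (bracket x v)"
    by simp
qed (simp_all add: module_hom.add[OF bracket_hom(1)] module_hom.add[OF bracket_hom(2)]
    module_hom.scale[OF bracket_hom(1)] module_hom.scale[OF bracket_hom(2)]
    module_hom.add[OF d_linear] module_hom.scale[OF d_linear] d_bracket)

definition adjoint_cohomology ::
  "nat \<Rightarrow> (('g list \<Rightarrow> 'g) \<times> ('g list \<Rightarrow> 'g)) set set"
where
  "adjoint_cohomology = adjoint.cohomology"

end


section \<open>Formal deformations\<close>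

text \<open>For a module \<open>g\<close>, the type \<open>'g fps\<close> is \<open>g[[t]]\<close>. Below are the scalar multiplication
  of \<open>k[[t]]\<close> on it and the extensions of power series of linear and bilinear maps.\<close>

definition fps_scale ::
  "('k::comm_ring_1 \<Rightarrow> 'g::ab_group_add \<Rightarrow> 'g) \<Rightarrow> 'k fps \<Rightarrow> 'g fps \<Rightarrow> 'g fps"
where
  "fps_scale scale a v = Abs_fps (\<lambda>n. \<Sum>i\<le>n. scale (fps_nth a i) (fps_nth v (n - i)))"

definition fps_map1 ::
  "(nat \<Rightarrow> 'g \<Rightarrow> 'g) \<Rightarrow> 'g::ab_group_add fps \<Rightarrow> 'g fps"
where
  "fps_map1 \<phi> x = Abs_fps (\<lambda>n. \<Sum>i\<le>n. \<phi> i (fps_nth x (n - i)))"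

definition fps_map2 ::
  "(nat \<Rightarrow> 'g \<Rightarrow> 'g \<Rightarrow> 'g) \<Rightarrow> 'g::ab_group_add fps \<Rightarrow> 'g fps \<Rightarrow> 'g fps"
where
  "fps_map2 \<mu> x y =
     Abs_fps (\<lambda>n. \<Sum>i\<le>n. \<Sum>j\<le>n - i. \<mu> i (fps_nth x j) (fps_nth y (n - i - j)))"

lemma (in module) module_fps_scale: "module (fps_scale scale)"
proof
  fix a b :: "'a fps" and x y :: "'b fps"
  show "fps_scale scale a (x + y) = fps_scale scale a x + fps_scale scale a y"
    by (simp add: fps_eq_iff fps_scale_def scale_right_distrib sum.distrib)
  show "fps_scale scale (a + b) x = fps_scale scale a x + fps_scale scale b x"
    by (simp add: fps_eq_iff fps_scale_def scale_left_distrib sum.distrib)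
  show "fps_scale scale 1 x = x"
  proof -
    have "(\<Sum>i\<le>n. scale (fps_nth 1 i) (fps_nth x (n - i))) =
          (\<Sum>i\<le>n. if i = 0 then fps_nth x n else 0)" for n
      by (rule sum.cong) (auto simp: scale_one scale_zero_left)
    then show ?thesis by (simp add: fps_eq_iff fps_scale_def)
  qed
  show "fps_scale scale a (fps_scale scale b x) = fps_scale scale (a * b) x"
  proof (rule fps_ext)
    fix n
    let ?h = "\<lambda>i j. scale (fps_nth a i * fps_nth b j) (fps_nth x (n - i - j))"
    have "fps_nth (fps_scale scale (a * b) x) n = (\<Sum>k\<le>n. \<Sum>i\<le>k. ?h i (k - i))"
      by (auto simp: fps_scale_def fps_mult_nth atLeast0AtMost scale_sum_left intro!: sum.cong)
    also have "\<dots> = (\<Sum>(i, j)\<in>{(i, j). i + j \<le> n}. ?h i j)"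
      by (rule sum.triangle_reindex_eq[symmetric])
    also have "{(i, j). i + j \<le> n} = (SIGMA i:{..n}. {..n - i})" by auto
    also have "(\<Sum>(i, j)\<in>(SIGMA i:{..n}. {..n - i}). ?h i j) = (\<Sum>i\<le>n. \<Sum>j\<le>n - i. ?h i j)"
      by (rule sum.Sigma[symmetric]) auto
    also have "\<dots> = fps_nth (fps_scale scale a (fps_scale scale b x)) n"
      by (simp add: fps_scale_def scale_sum_right)
    finally show "fps_nth (fps_scale scale a (fps_scale scale b x)) n =
        fps_nth (fps_scale scale (a * b) x) n" by simp
  qed
qed

definition formal_deformation ::
  "('k::field_char_0 \<Rightarrow> 'g::ab_group_add \<Rightarrow> 'g) \<Rightarrow> ('g \<Rightarrow> 'g \<Rightarrow> 'g) \<Rightarrow> 'k \<Rightarrow> ('g \<Rightarrow> 'g) \<Rightarrow>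
   (nat \<Rightarrow> 'g \<Rightarrow> 'g \<Rightarrow> 'g) \<Rightarrow> (nat \<Rightarrow> 'g \<Rightarrow> 'g) \<Rightarrow> bool"
where
  "formal_deformation scale bracket wt d \<mu> D \<longleftrightarrow>
     (\<forall>i. alternating_bilinear scale (\<mu> i)) \<and>
     (\<forall>i. module_hom scale scale (D i)) \<and>
     differential_lie_algebra (fps_scale scale) (fps_map2 \<mu>) (fps_const wt) (fps_map1 D) \<and>
     \<mu> 0 = bracket \<and> D 0 = d"

definition equivalent_deformations ::
  "('k::field_char_0 \<Rightarrow> 'g::ab_group_add \<Rightarrow> 'g) \<Rightarrow>
   (nat \<Rightarrow> 'g \<Rightarrow> 'g \<Rightarrow> 'g) \<Rightarrow> (nat \<Rightarrow> 'g \<Rightarrow> 'g) \<Rightarrow>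
   (nat \<Rightarrow> 'g \<Rightarrow> 'g \<Rightarrow> 'g) \<Rightarrow> (nat \<Rightarrow> 'g \<Rightarrow> 'g) \<Rightarrow> bool"
where
  "equivalent_deformations scale \<mu> D \<mu>' D' \<longleftrightarrow>
     (\<exists>\<phi>. (\<forall>i. module_hom scale scale (\<phi> i)) \<and> \<phi> 0 = id \<and>
        (\<forall>x y. fps_map1 \<phi> (fps_map2 \<mu>' x y) = fps_map2 \<mu> (fps_map1 \<phi> x) (fps_map1 \<phi> y)) \<and>
        (\<forall>x. fps_map1 \<phi> (fps_map1 D' x) = fps_map1 D (fps_map1 \<phi> x)))"

text \<open>The pair \<open>(\<mu>\<^sub>1, D\<^sub>1)\<close> as a cochain of degree 2.\<close>

definition infinitesimal ::
  "(nat \<Rightarrow> 'g \<Rightarrow> 'g \<Rightarrow> 'g) \<Rightarrow> (nat \<Rightarrow> 'g \<Rightarrow> 'g) \<Rightarrow>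
   ('g list \<Rightarrow> 'g::ab_group_add) \<times> ('g list \<Rightarrow> 'g)"
where
  "infinitesimal \<mu> D =
     ((\<lambda>xs. case xs of [x, y] \<Rightarrow> \<mu> 1 x y | _ \<Rightarrow> 0),
      (\<lambda>xs. case xs of [x] \<Rightarrow> D 1 x | _ \<Rightarrow> 0))"

end

theory Submission
  imports Defs
begin

text \<open>Evaluated at constant series and read off in degree 1, the axioms of a deformation say
  that its infinitesimal is a cocycle, and the two compatibility conditions of an
  equivalence \<open>\<phi>\<close> say that the infinitesimals differ by the coboundary of the cochain
  \<open>\<phi>\<^sub>1\<close>.\<close>

section \<open>Coefficients of extended maps\<close>

text \<open>A constant series has coefficient 0 in every positive degree, so only the summand
  \<open>i = n\<close> can differ from \<open>\<phi> i 0\<close>. Linearity enters through the value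
  at 0 alone.\<close>

lemma fps_map1_const:
  assumes "\<And>i. \<phi> i 0 = 0"
  shows "fps_map1 \<phi> (fps_const x) = Abs_fps (\<lambda>n. \<phi> n x)"
proof (rule fps_ext)
  fix n
  have "fps_nth (fps_map1 \<phi> (fps_const x)) n = (\<Sum>i\<le>n. if i = n then \<phi> n x else 0)"
    unfolding fps_map1_def fps_nth_Abs_fps by (rule sum.cong) (auto simp: assms)
  then show "fps_nth (fps_map1 \<phi> (fps_const x)) n = fps_nth (Abs_fps (\<lambda>n. \<phi> n x)) n"
    by simp
qed

lemma fps_map2_const:
  assumes "\<And>i y. \<mu> i 0 y = 0" "\<And>i x. \<mu> i x 0 = 0"
  shows "fps_map2 \<mu> (fps_const x) (fps_const y) = Abs_fps (\<lambda>n. \<mu> n x y)"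
proof (rule fps_ext)
  fix n
  \<comment> \<open>The first argument leaves only \<open>j = 0\<close>; the second then has index
    \<open>n - i\<close>, which leaves only \<open>i = n\<close> in the outer sum.\<close>
  have "(\<Sum>j\<le>n - i. \<mu> i (fps_nth (fps_const x) j) (fps_nth (fps_const y) (n - i - j))) =
      (if i = n then \<mu> n x y else 0)" if "i \<le> n" for i
  proof -
    have "(\<Sum>j\<le>n - i. \<mu> i (fps_nth (fps_const x) j) (fps_nth (fps_const y) (n - i - j))) =
        (\<Sum>j\<le>n - i. if j = 0 then if i = n then \<mu> n x y else 0 else 0)"
      using that by (intro sum.cong) (auto simp: assms)
    then show ?thesis by simp
  qed
  then have "fps_nth (fps_map2 \<mu> (fps_const x) (fps_const y)) n =
      (\<Sum>i\<le>n. if i = n then \<mu> n x y else 0)"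
    unfolding fps_map2_def fps_nth_Abs_fps by (intro sum.cong) auto
  then show "fps_nth (fps_map2 \<mu> (fps_const x) (fps_const y)) n =
      fps_nth (Abs_fps (\<lambda>n. \<mu> n x y)) n"
    by simp
qed

text \<open>Stated for arbitrary series: in the nested terms of the axioms only the innermost
  arguments are constant.\<close>

lemma fps_map1_nth_1:
  "fps_nth (fps_map1 \<phi> x) 1 = \<phi> 0 (fps_nth x 1) + \<phi> 1 (fps_nth x 0)"
  by (simp add: fps_map1_def)

lemma fps_map2_nth_1:
  "fps_nth (fps_map2 \<mu> x y) 1 =
     \<mu> 0 (fps_nth x 0) (fps_nth y 1) + \<mu> 0 (fps_nth x 1) (fps_nth y 0)
     + \<mu> 1 (fps_nth x 0) (fps_nth y 0)"
  by (simp add: fps_map2_def)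

text \<open>The weight of the deformed structure is the constant series \<open>fps_const wt\<close>,
  so multiplying by it does not mix degrees.\<close>

lemma (in module) fps_scale_const_nth:
  "fps_nth (fps_scale scale (fps_const a) x) n = scale a (fps_nth x n)"
proof -
  have "(\<Sum>i\<le>n. scale (fps_nth (fps_const a) i) (fps_nth x (n - i))) =
      (\<Sum>i\<le>n. if i = 0 then scale a (fps_nth x n) else 0)"
    by (rule sum.cong) (auto simp: scale_zero_left)
  then show ?thesis by (simp add: fps_scale_def)
qed

lemma alternating_bilinearD:
  assumes "alternating_bilinear scale m"
  shows "module_hom scale scale (m x)" "module_hom scale scale (\<lambda>x. m x y)"
    "m x x = 0" "m 0 y = 0" "m x 0 = 0" "m x y = - m y x"
proof -
  show hom: "module_hom scale scale (m x)" "module_hom scale scale (\<lambda>x. m x y)" "m x x = 0" for x y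
    using assms by (auto simp: alternating_bilinear_def)
  show "m 0 y = 0" "m x 0 = 0"
    using module_hom.zero[OF hom(1)] module_hom.zero[OF hom(2)] by auto
  have "m x y + m y x = m (x + y) (x + y)"
    unfolding module_hom.add[OF hom(1)] module_hom.add[OF hom(2)]
    by (simp add: hom(3) add.commute)
  then show "m x y = - m y x"
    by (simp add: hom(3) eq_neg_iff_add_eq_0)
qed

section \<open>Cochains of low degree\<close>

context differential_lie_algebra
begin

text \<open>The default 0 is the one \<open>Hom_wedge\<close> demands. With the map as a parameter,
  the same formulas serve \<open>D 1\<close>, \<open>\<phi> 1\<close> and the zero map.\<close>

definition cochain1 :: "('g \<Rightarrow> 'g) \<Rightarrow> 'g list \<Rightarrow> 'g" where
  "cochain1 g = (\<lambda>xs. case xs of [x] \<Rightarrow> g x | _ \<Rightarrow> 0)"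

definition cochain2 :: "('g \<Rightarrow> 'g \<Rightarrow> 'g) \<Rightarrow> 'g list \<Rightarrow> 'g" where
  "cochain2 m = (\<lambda>xs. case xs of [x, y] \<Rightarrow> m x y | _ \<Rightarrow> 0)"

lemma cochain1_simps [simp]:
  "cochain1 g [x] = g x" "length xs \<noteq> 1 \<Longrightarrow> cochain1 g xs = 0"
  by (auto simp: cochain1_def split: list.splits)

lemma cochain2_simps [simp]:
  "cochain2 m [x, y] = m x y" "length xs \<noteq> 2 \<Longrightarrow> cochain2 m xs = 0"
  by (auto simp: cochain2_def split: list.splits)

lemma infinitesimal_eq: "infinitesimal \<mu> D = (cochain2 (\<mu> 1), cochain1 (D 1))"
  unfolding infinitesimal_def cochain1_def cochain2_def ..

lemma cochain1_Hom_wedge: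
  assumes "module_hom scale scale g"
  shows "cochain1 g \<in> adjoint.Hom_wedge 1"
  using assms by (auto simp: adjoint.Hom_wedge_def length_Suc_conv)

lemma cochain2_Hom_wedge:
  assumes "alternating_bilinear scale m"
  shows "cochain2 m \<in> adjoint.Hom_wedge 2"
  using alternating_bilinearD(1-3)[OF assms]
  by (auto simp: adjoint.Hom_wedge_def length_Suc_conv numeral_2_eq_2 less_Suc_eq)

lemma lie_diff_cochain1:
  "adjoint.lie_diff 1 (cochain1 g) =
     cochain2 (\<lambda>x y. bracket x (g y) - bracket y (g x) - g (bracket x y))"
proof
  fix xs :: "'g list"
  show "adjoint.lie_diff 1 (cochain1 g) xs =
      cochain2 (\<lambda>x y. bracket x (g y) - bracket y (g x) - g (bracket x y)) xs"
  proof (cases "length xs = 2")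
    case True
    then obtain x y where "xs = [x, y]"
      by (auto simp: length_Suc_conv numeral_2_eq_2)
    then show ?thesis
      by (simp add: adjoint.lie_diff_def adjoint.ce_diff_def nths_Cons)
  qed (simp add: adjoint.lie_diff_def adjoint.ce_diff_def)
qed

lemma do_diff_cochain1:
  "adjoint.do_diff 1 (cochain1 g) =
     cochain2 (\<lambda>x y. bracket (x + scale wt (d x)) (g y) - bracket (y + scale wt (d y)) (g x)
       - g (bracket x y))"
proof
  fix xs :: "'g list"
  show "adjoint.do_diff 1 (cochain1 g) xs =
      cochain2 (\<lambda>x y. bracket (x + scale wt (d x)) (g y) - bracket (y + scale wt (d y)) (g x)
       - g (bracket x y)) xs"
  proof (cases "length xs = 2")
    case True
    then obtain x y where "xs = [x, y]"
      by (auto simp: length_Suc_conv numeral_2_eq_2)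
    then show ?thesis
      by (simp add: adjoint.do_diff_def adjoint.ce_diff_def adjoint.rho_wt_def nths_Cons)
  qed (simp add: adjoint.do_diff_def adjoint.ce_diff_def)
qed

text \<open>Degree 1 cochains have second component 0, yet \<open>differential 1\<close> still
  applies \<open>do_diff 0\<close> to it; this removes that term.\<close>

lemma do_diff_0: "adjoint.do_diff n 0 = 0"
  by (rule ext)
    (simp add: adjoint.do_diff_def adjoint.ce_diff_def adjoint.rho_wt_def
      module_hom.zero[OF bracket_hom(1)])

lemma delta_cochain1:
  "adjoint.delta 1 (cochain1 g) = cochain1 (\<lambda>x. g (d x) - d (g x))"
proof
  fix xs :: "'g list"
  have I: "{I. I \<subseteq> {..<Suc 0} \<and> card I = Suc 0} = {{0}}"
    by (auto simp: card_1_singleton_iff)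
  show "adjoint.delta 1 (cochain1 g) xs = cochain1 (\<lambda>x. g (d x) - d (g x)) xs"
  proof (cases "length xs = 1")
    case True
    then obtain x where "xs = [x]"
      by (auto simp: length_Suc_conv)
    then show ?thesis
      by (simp add: adjoint.delta_def I)
  qed (simp add: adjoint.delta_def)
qed

lemma delta_cochain2:
  "adjoint.delta 2 (cochain2 m) =
     cochain2 (\<lambda>x y. m (d x) y + m x (d y) + scale wt (m (d x) (d y)) - d (m x y))"
proof
  fix xs :: "'g list"
  \<comment> \<open>Listing the power set once reduces both index sets of \<open>delta 2\<close> to
    a selection by cardinality among four sets.\<close>
  have subsets: "{I. I \<subseteq> {..<2} \<and> card I = k} = {I \<in> {{}, {0}, {1}, {0, 1 :: nat}}. card I = k}" for k
  proof -
    have "Pow {..<2} = {{}, {0}, {1}, {0, 1 :: nat}}"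
      by (simp add: numeral_2_eq_2 lessThan_Suc Pow_insert insert_commute)
    moreover have "{I. I \<subseteq> {..<2} \<and> card I = k} = {I \<in> Pow {..<2 :: nat}. card I = k}"
      by simp
    ultimately show ?thesis by simp
  qed
  have I: "{I. I \<subseteq> {..<2} \<and> card I = 1} = {{0}, {1 :: nat}}"
    "{I. I \<subseteq> {..<2} \<and> card I = 2} = {{0, 1 :: nat}}"
    unfolding subsets by auto
  have ivl: "{1..2} = {1, 2 :: nat}" "[0..<2] = [0, 1]"
    by (auto simp: numeral_2_eq_2)
  show "adjoint.delta 2 (cochain2 m) xs =
      cochain2 (\<lambda>x y. m (d x) y + m x (d y) + scale wt (m (d x) (d y)) - d (m x y)) xs"
  proof (cases "length xs = 2")
    case True
    then obtain x y where "xs = [x, y]"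
      by (auto simp: length_Suc_conv numeral_2_eq_2)
    then show ?thesis
      unfolding adjoint.delta_def ivl using I by simp
  qed (simp add: adjoint.delta_def)
qed

text \<open>The assumption is the Chevalley-Eilenberg formula on a triple. Triples decide the claim,
  because \<open>ce_diff\<close> is 0 by definition on lists of other lengths.\<close>

lemma lie_diff_cochain2_eq_0:
  assumes "\<And>x y z. - bracket x (m y z) + bracket y (m x z) - bracket z (m x y)
    + m (bracket x y) z - m (bracket x z) y + m (bracket y z) x = 0"
  shows "adjoint.lie_diff 2 (cochain2 m) = 0"
proof
  fix xs :: "'g list"
  show "adjoint.lie_diff 2 (cochain2 m) xs = 0 xs"
  proof (cases "length xs = 3")
    case True
    then obtain x y z where "xs = [x, y, z]"
      by (auto simp: length_Suc_conv numeral_3_eq_3)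
    then show ?thesis
      using assms[of x y z]
      by (simp add: adjoint.lie_diff_def adjoint.ce_diff_def nths_Cons numeral_2_eq_2 algebra_simps)
  qed (simp add: adjoint.lie_diff_def adjoint.ce_diff_def)
qed

text \<open>The witness is the image of \<open>c\<close> under \<open>cohomologous 2\<close>. The
  given difference puts \<open>c'\<close> into it, and reflexivity at \<open>c\<close> puts
  \<open>c\<close> into it.\<close>

lemma cohomologous_sameI:
  assumes "c \<in> adjoint.cocycles 2" "c' \<in> adjoint.cocycles 2"
    and "module_hom scale scale g"
    and "c - c' = adjoint.differential 1 (cochain1 g, 0)"
  shows "\<exists>C \<in> adjoint_cohomology 2. c \<in> C \<and> c' \<in> C"
proof -
  \<comment> \<open>Kept general in \<open>f\<close>: it is applied to \<open>g\<close> and to the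
    zero map.\<close>
  have im: "adjoint.differential 1 (cochain1 f, 0) \<in> adjoint.coboundaries 2"
    if "module_hom scale scale f" for f
    using cochain1_Hom_wedge[OF that] by (auto simp: adjoint.coboundaries_def adjoint.cochains_def)
  \<comment> \<open>Reflexivity at \<open>c\<close> means that 0 is a coboundary; it is the image of
    the zero cochain.\<close>
  have "cochain1 (\<lambda>_. 0) = 0" "cochain2 (\<lambda>_ _. 0) = 0"
    by (auto simp: cochain1_def cochain2_def fun_eq_iff split: list.splits)
  then have "adjoint.differential 1 (cochain1 (\<lambda>_. 0), 0) = 0"
    using do_diff_0[of 0] lie_diff_cochain1[of "\<lambda>_. 0"] delta_cochain1[of "\<lambda>_. 0"]
    by (simp add: adjoint.differential_def module_hom.zero[OF bracket_hom(1)]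
        module_hom.zero[OF d_linear] zero_prod_def)
  moreover have "module_hom scale scale (\<lambda>_. 0)"
    by unfold_locales simp_all
  ultimately have "0 \<in> adjoint.coboundaries 2"
    using im[of "\<lambda>_. 0"] by simp
  then have "(c, c) \<in> adjoint.cohomologous 2" "(c, c') \<in> adjoint.cohomologous 2"
    using assms im by (auto simp: adjoint.cohomologous_def)
  then show ?thesis
    using assms(1) quotientI[of c "adjoint.cocycles 2" "adjoint.cohomologous 2"]
    unfolding adjoint_cohomology_def adjoint.cohomology_def by blast
qed

section \<open>Infinitesimals\<close>

text \<open>The t-coefficient of the Jacobi identity is the first component of the cocycle equation,
  and that of the weighted Leibniz rule is the second.\<close>

lemma infinitesimal_cocycle:
  fixes \<mu> :: "nat \<Rightarrow> 'g \<Rightarrow> 'g \<Rightarrow> 'g" and D :: "nat \<Rightarrow> 'g \<Rightarrow> 'g"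
  assumes alt: "\<And>i. alternating_bilinear scale (\<mu> i)"
    and lin: "\<And>i. module_hom scale scale (D i)"
    and def: "differential_lie_algebra (fps_scale scale) (fps_map2 \<mu>) (fps_const wt) (fps_map1 D)"
    and base: "\<mu> 0 = bracket" "D 0 = d"
  shows "infinitesimal \<mu> D \<in> adjoint.cocycles 2"
proof -
  interpret def: differential_lie_algebra "fps_scale scale" "fps_map2 \<mu>" "fps_const wt" "fps_map1 D"
    by (rule def)
  note alt' = alternating_bilinearD[OF alt]
  note const = fps_map1_const[of D, OF module_hom.zero[OF lin]] fps_map2_const[of \<mu>, OF alt'(4,5)]
  note nth = fps_map1_nth_1 fps_map2_nth_1 fps_scale_const_nth
  \<comment> \<open>In each cyclic term either the inner or the outer map contributes its degree 1
    part; the third term vanishes because the outer constant argument has no t-coefficient.\<close>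
  have jac1: "bracket x (\<mu> 1 y z) + \<mu> 1 x (bracket y z)
      + (bracket y (\<mu> 1 z x) + \<mu> 1 y (bracket z x))
      + (bracket z (\<mu> 1 x y) + \<mu> 1 z (bracket x y)) = 0" for x y z
    using arg_cong[OF def.jacobi[of "fps_const x" "fps_const y" "fps_const z"], of "\<lambda>f. fps_nth f 1"]
    by (simp add: const nth[simplified] base module_hom.zero[OF bracket_hom(2)])
  \<comment> \<open>This is minus \<open>jac1\<close>: skew-symmetry of \<open>bracket\<close> and
    \<open>\<mu> 1\<close> turns the cyclic order into the Chevalley-Eilenberg order and
    signs.\<close>
  have lie: "- bracket x (\<mu> 1 y z) + bracket y (\<mu> 1 x z) - bracket z (\<mu> 1 x y)
      + \<mu> 1 (bracket x y) z - \<mu> 1 (bracket x z) y + \<mu> 1 (bracket y z) x = 0" for x y z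
  proof -
    have "bracket y (\<mu> 1 z x) = - bracket y (\<mu> 1 x z)"
      using alt'(6)[of 1 z x] by (simp add: module_hom.neg[OF bracket_hom(1)])
    moreover have "\<mu> 1 y (bracket z x) = \<mu> 1 (bracket x z) y"
      using alt'(6)[of 1 y "bracket z x"] bracket_skew[of z x]
      by (simp add: module_hom.neg[OF alt'(2)])
    ultimately show ?thesis
      using jac1[of x y z] alt'(6)[of 1 x "bracket y z"] alt'(6)[of 1 z "bracket x y"]
      by (simp add: algebra_simps)
  qed
  have d1: "d (\<mu> 1 x y) + D 1 (bracket x y) =
      bracket (D 1 x) y + \<mu> 1 (d x) y + (bracket x (D 1 y) + \<mu> 1 x (d y))
      + scale wt (bracket (d x) (D 1 y) + bracket (D 1 x) (d y) + \<mu> 1 (d x) (d y))" for x y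
    using arg_cong[OF def.d_bracket[of "fps_const x" "fps_const y"], of "\<lambda>f. fps_nth f 1"]
    by (simp add: const nth[simplified] base module_hom.zero[OF bracket_hom(1)]
        module_hom.zero[OF bracket_hom(2)])
  \<comment> \<open>The weight terms of \<open>d1\<close> that contain \<open>D 1\<close> merge with
    \<open>bracket x (D 1 y)\<close> and \<open>bracket (D 1 x) y\<close> into the twisted action
    \<open>rho_wt\<close>; the terms in \<open>\<mu> 1\<close> form \<open>delta 2\<close>.\<close>
  have "- (bracket (x + scale wt (d x)) (D 1 y) - bracket (y + scale wt (d y)) (D 1 x)
       - D 1 (bracket x y))
     - (\<mu> 1 (d x) y + \<mu> 1 x (d y) + scale wt (\<mu> 1 (d x) (d y)) - d (\<mu> 1 x y)) = 0" for x y
    using d1[of x y] bracket_skew[of y "D 1 x"] bracket_skew[of "d y" "D 1 x"]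
    by (simp add: module_hom.add[OF bracket_hom(2)] module_hom.scale[OF bracket_hom(2)]
        scale_right_distrib algebra_simps)
  then have "- adjoint.do_diff 1 (cochain1 (D 1)) - adjoint.delta 2 (cochain2 (\<mu> 1)) = 0"
    unfolding do_diff_cochain1 delta_cochain2
    by (auto simp: cochain2_def fun_eq_iff split: list.splits)
  then have "adjoint.differential 2 (infinitesimal \<mu> D) = 0"
    using lie_diff_cochain2_eq_0[of "\<mu> 1", OF lie]
    by (simp add: adjoint.differential_def infinitesimal_eq zero_prod_def)
  then show ?thesis
    using cochain1_Hom_wedge[OF lin[of 1]] cochain2_Hom_wedge[OF alt[of 1]]
    by (simp add: adjoint.cocycles_def adjoint.cochains_def infinitesimal_eq)
qed

text \<open>As \<open>\<phi> 0\<close> is the identity, the t-coefficients of both conditions are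
  linear in \<open>\<phi> 1\<close>. The equivalence maps the primed structure to the unprimed one,
  hence the order of the difference.\<close>

lemma infinitesimal_diff:
  fixes \<mu> \<mu>' :: "nat \<Rightarrow> 'g \<Rightarrow> 'g \<Rightarrow> 'g" and D D' \<phi> :: "nat \<Rightarrow> 'g \<Rightarrow> 'g"
  assumes alt: "\<And>i. alternating_bilinear scale (\<mu>' i)"
    and lin: "\<And>i. module_hom scale scale (D' i)" "\<And>i. module_hom scale scale (\<phi> i)"
    and base: "\<mu> 0 = bracket" "D 0 = d" "\<mu>' 0 = bracket" "D' 0 = d" "\<phi> 0 = id"
    and bracket_compat:
      "\<And>x y. fps_map1 \<phi> (fps_map2 \<mu>' x y) = fps_map2 \<mu> (fps_map1 \<phi> x) (fps_map1 \<phi> y)"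
    and d_compat: "\<And>x. fps_map1 \<phi> (fps_map1 D' x) = fps_map1 D (fps_map1 \<phi> x)"
  shows "infinitesimal \<mu>' D' - infinitesimal \<mu> D = adjoint.differential 1 (cochain1 (\<phi> 1), 0)"
proof -
  note alt' = alternating_bilinearD[OF alt]
  note const = fps_map1_const[of D', OF module_hom.zero[OF lin(1)]]
    fps_map1_const[of \<phi>, OF module_hom.zero[OF lin(2)]] fps_map2_const[of \<mu>', OF alt'(4,5)]
  note nth = fps_map1_nth_1 fps_map2_nth_1
  have "\<mu>' 1 x y + \<phi> 1 (bracket x y) = bracket x (\<phi> 1 y) + bracket (\<phi> 1 x) y + \<mu> 1 x y" for x y
    using arg_cong[OF bracket_compat[of "fps_const x" "fps_const y"], of "\<lambda>f. fps_nth f 1"]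
    by (simp add: const nth[simplified] base)
  \<comment> \<open>Skew-symmetry rewrites \<open>bracket (\<phi> 1 x) y\<close> to reach the form
    of \<open>lie_diff 1\<close>.\<close>
  then have mu: "\<mu>' 1 x y - \<mu> 1 x y = bracket x (\<phi> 1 y) - bracket y (\<phi> 1 x) - \<phi> 1 (bracket x y)"
    for x y
    using bracket_skew[of y "\<phi> 1 x"] by (simp add: algebra_simps)
  have "D' 1 x + \<phi> 1 (d x) = d (\<phi> 1 x) + D 1 x" for x
    using arg_cong[OF d_compat[of "fps_const x"], of "\<lambda>f. fps_nth f 1"]
    by (simp add: const nth[simplified] base)
  \<comment> \<open>The minus sign is the one in front of \<open>delta\<close> in
    \<open>differential\<close>.\<close>
  then have "D' 1 x - D 1 x = - (\<phi> 1 (d x) - d (\<phi> 1 x))" for x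
    by (simp add: algebra_simps)
  then have "cochain1 (D' 1) - cochain1 (D 1) = - adjoint.delta 1 (cochain1 (\<phi> 1))"
    unfolding delta_cochain1 by (auto simp: cochain1_def fun_eq_iff split: list.splits)
  moreover have "cochain2 (\<mu>' 1) - cochain2 (\<mu> 1) = adjoint.lie_diff 1 (cochain1 (\<phi> 1))"
    unfolding lie_diff_cochain1 using mu by (auto simp: cochain2_def fun_eq_iff split: list.splits)
  ultimately show ?thesis
    using do_diff_0[of 0] by (simp add: adjoint.differential_def infinitesimal_eq)
qed

end

theorem theorem3p7:
  fixes scale :: "'k::field_char_0 \<Rightarrow> 'g::ab_group_add \<Rightarrow> 'g"
    and bracket :: "'g \<Rightarrow> 'g \<Rightarrow> 'g"
    and wt :: 'k
    and d :: "'g \<Rightarrow> 'g"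
    and \<mu> \<mu>' :: "nat \<Rightarrow> 'g \<Rightarrow> 'g \<Rightarrow> 'g"
    and D D' :: "nat \<Rightarrow> 'g \<Rightarrow> 'g"
  assumes "differential_lie_algebra scale bracket wt d"
    and "formal_deformation scale bracket wt d \<mu> D"
    and "formal_deformation scale bracket wt d \<mu>' D'"
    and "equivalent_deformations scale \<mu> D \<mu>' D'"
  shows "\<exists>c \<in> differential_lie_algebra.adjoint_cohomology scale bracket wt d 2.
           infinitesimal \<mu> D \<in> c \<and> infinitesimal \<mu>' D' \<in> c"
proof -
  interpret differential_lie_algebra scale bracket wt d by (rule assms(1))
  obtain \<phi> where \<phi>: "\<And>i. module_hom scale scale (\<phi> i)" "\<phi> 0 = id"
    "\<And>x y. fps_map1 \<phi> (fps_map2 \<mu>' x y) = fps_map2 \<mu> (fps_map1 \<phi> x) (fps_map1 \<phi> y)"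
    "\<And>x. fps_map1 \<phi> (fps_map1 D' x) = fps_map1 D (fps_map1 \<phi> x)"
    using assms(4) by (auto simp: equivalent_deformations_def)
  have "infinitesimal \<mu> D \<in> adjoint.cocycles 2"
    by (rule infinitesimal_cocycle) (use assms(2) in \<open>simp_all add: formal_deformation_def\<close>)
  moreover have "infinitesimal \<mu>' D' \<in> adjoint.cocycles 2"
    by (rule infinitesimal_cocycle) (use assms(3) in \<open>simp_all add: formal_deformation_def\<close>)
  \<comment> \<open>With this order of the difference, the class found is that of the primed
    infinitesimal.\<close>
  moreover have "infinitesimal \<mu>' D' - infinitesimal \<mu> D =
      adjoint.differential 1 (cochain1 (\<phi> 1), 0)"
    by (rule infinitesimal_diff)
      (use assms(2,3) \<phi> in \<open>simp_all add: formal_deformation_def del: id_apply\<close>)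
  ultimately show ?thesis
    using cohomologous_sameI[OF _ _ \<phi>(1)] by blast
qed

end
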